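(* Let $A$ and $B$ form a dual pair of closed densely defined operators in a Hilbert space $\mathfrak{H}$. Then: (i) The operator $$S=\begin{pmatrix} 0 & A \\ B & 0 \end{pmatrix},\qquad\mathrm{dom}(S)=\mathrm{dom}(B)\times\mathrm{dom}(A),$$ is a symmetric operator in $\mathfrak{H}^2=\mathfrak{H}\oplus\mathfrak{H}$ with equal deficiency indices, $$n_+(S)=n_-(S)=n(A^*,B)=n(B^*,A).$$ (ii) $S$ is selfadjoint if and only if $A=B^*$.
   Context: Operators $A,B$ in $\mathfrak{H}$ form a dual pair $\{A,B\}$ if $(Af,g)=(f,Bg)$ for all $f\in\mathrm{dom}\,A$, $g\in\mathrm{dom}\,B$. Notation: $n(A^*,B)=\dim(\mathrm{dom}\,A^*/\mathrm{dom}\,B)$, $n(B^*,A)=\dim(\mathrm{dom}\,B^*/\mathrm{dom}\,A)$, and $n_\pm(S)=\dim\ker(S^*\mp i)$. *)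

theory Defs
  imports "HOL-Analysis.Analysis"
begin

unbundle cardinal_syntax

section \<open>Complex Hilbert spaces\<close>

text \<open>
  The real structure (vector space, norm, metric, topology) is that of \<^class>\<open>real_inner\<close>;
  the complex structure is tied to it by \<open>scaleR_scaleC\<close> and \<open>inner_cinner\<close>.
  The inner product is linear in its first argument.  Positivity and definiteness follow from
  those of the real inner product, since \<open>cinner x x\<close> is real by \<open>cinner_commute\<close>.
\<close>

class complex_inner = real_inner +
  fixes scaleC :: "complex \<Rightarrow> 'a \<Rightarrow> 'a"  (infixr \<open>*\<^sub>C\<close> 75)
    and cinner :: "'a \<Rightarrow> 'a \<Rightarrow> complex"
  assumes scaleC_add_right: "c *\<^sub>C (x + y) = c *\<^sub>C x + c *\<^sub>C y"
    and scaleC_add_left: "(c + d) *\<^sub>C x = c *\<^sub>C x + d *\<^sub>C x"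
    and scaleC_scaleC: "c *\<^sub>C d *\<^sub>C x = (c * d) *\<^sub>C x"
    and scaleC_one: "1 *\<^sub>C x = x"
    and scaleR_scaleC: "r *\<^sub>R x = complex_of_real r *\<^sub>C x"
    and cinner_add_left: "cinner (x + y) z = cinner x z + cinner y z"
    and cinner_scaleC_left: "cinner (c *\<^sub>C x) y = c * cinner x y"
    and cinner_commute: "cinner x y = cnj (cinner y x)"
    and inner_cinner: "inner x y = Re (cinner x y)"

class chilbert_space = complex_inner + complete_space

interpretation cvec: vector_space "scaleC :: complex \<Rightarrow> 'a \<Rightarrow> 'a::complex_inner"
  by unfold_locales (simp_all add: scaleC_add_right scaleC_add_left scaleC_scaleC scaleC_one)

text \<open>The orthogonal sum \<open>H \<oplus> K\<close>, on the library's product of real inner product spaces.\<close>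

instantiation prod :: (complex_inner, complex_inner) complex_inner
begin

definition scaleC_prod_def: "c *\<^sub>C p = (c *\<^sub>C fst p, c *\<^sub>C snd p)"

definition cinner_prod_def: "cinner p q = cinner (fst p) (fst q) + cinner (snd p) (snd q)"

instance
proof
  fix p q :: "'a \<times> 'b"
  show "cinner p q = cnj (cinner q p)"
    unfolding cinner_prod_def complex_cnj_add
    by (simp add: cinner_commute[of "fst p"] cinner_commute[of "snd p"])
qed (simp_all add: scaleC_prod_def cinner_prod_def scaleC_add_right scaleC_add_left scaleC_scaleC
    scaleC_one scaleR_scaleC cinner_add_left cinner_scaleC_left inner_prod_def inner_cinner
    prod_eq_iff algebra_simps)

end

instance prod :: (chilbert_space, chilbert_space) chilbert_space ..


section \<open>Dimension of a quotient of subspaces\<close>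

text \<open>
  For subspaces \<open>W \<subseteq> V\<close>: the cosets \<open>b + W\<close>, \<open>b \<in> X\<close>, are pairwise distinct and form a
  (Hamel) basis of \<open>V / W\<close>.  Here \<open>b\<close> lies in the span of \<open>W \<union> (X - {b})\<close> iff \<open>b + W\<close> is a linear
  combination of the other cosets.
\<close>

definition basis_mod :: "'a::complex_inner set \<Rightarrow> 'a set \<Rightarrow> 'a set \<Rightarrow> bool" where
  "basis_mod V W X \<longleftrightarrow>
     X \<subseteq> V \<and> (\<forall>b\<in>X. b \<notin> cvec.span (W \<union> (X - {b}))) \<and> V \<subseteq> cvec.span (W \<union> X)"

text \<open>
  Dimensions are cardinals, so infinite ones are kept apart; they are compared with \<open>=o\<close>.
  The lemmas \<open>basis_mod_exists_bij\<close> and \<open>quot_dim_eq_card_of\<close> below show that the choice is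
  harmless.
\<close>

definition quot_dim :: "'a::complex_inner set \<Rightarrow> 'a set \<Rightarrow> 'a rel" where
  "quot_dim V W = |SOME X. basis_mod V W X|"

definition cdimension :: "'a::complex_inner set \<Rightarrow> 'a rel" where
  "cdimension V = quot_dim V {0}"

lemma basis_mod_exists_bij:
  fixes V W :: "'a::complex_inner set"
  assumes W: "cvec.subspace W" and V: "cvec.subspace V" and WV: "W \<subseteq> V"
  obtains X where "basis_mod V W X" and "\<And>Y. basis_mod V W Y \<Longrightarrow> \<exists>f. bij_betw f Y X"
proof -
  obtain D where D: "D \<subseteq> W" "cvec.independent D" "W \<subseteq> cvec.span D"
    using cvec.maximal_independent_subset by blast
  obtain E where E: "D \<subseteq> E" "E \<subseteq> V" "cvec.independent E" "V \<subseteq> cvec.span E"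
    using cvec.maximal_independent_subset_extend[of D V] D WV by blast
  define X where "X = E - D"
  have XV: "X \<subseteq> V" using E by (auto simp: X_def)
  have spanX: "V \<subseteq> cvec.span (W \<union> X)"
  proof -
    have "E \<subseteq> W \<union> X" using D(1) by (auto simp: X_def)
    then show ?thesis using E(4) cvec.span_mono by blast
  qed
  have indepX: "b \<notin> cvec.span (W \<union> (X - {b}))" if b: "b \<in> X" for b
  proof
    assume "b \<in> cvec.span (W \<union> (X - {b}))"
    moreover have "W \<union> (X - {b}) \<subseteq> cvec.span (E - {b})"
    proof -
      have "D \<subseteq> E - {b}" using b E(1) by (auto simp: X_def)
      then have "W \<subseteq> cvec.span (E - {b})" using D(3) cvec.span_mono by blast
      moreover have "X - {b} \<subseteq> cvec.span (E - {b})"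
        using cvec.span_superset[of "E - {b}"] by (auto simp: X_def)
      ultimately show ?thesis by blast
    qed
    ultimately have "b \<in> cvec.span (E - {b})"
      using cvec.span_minimal[OF _ cvec.subspace_span] by blast
    then show False using E(3) b unfolding cvec.dependent_def X_def by blast
  qed
  have basisX: "basis_mod V W X"
    unfolding basis_mod_def using XV spanX indepX by blast
  interpret vp: vector_space_pair "scaleC :: complex \<Rightarrow> 'a \<Rightarrow> 'a" "scaleC :: complex \<Rightarrow> 'a \<Rightarrow> 'a" ..
  obtain p where lin: "Vector_Spaces.linear (*\<^sub>C) (*\<^sub>C) p"
    and p: "\<And>x. x \<in> E \<Longrightarrow> p x = (if x \<in> D then 0 else x)"
    using vp.linear_independent_extend[OF E(3), of "\<lambda>x. if x \<in> D then 0 else x"] by blast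
  interpret p: Vector_Spaces.linear "scaleC :: complex \<Rightarrow> 'a \<Rightarrow> 'a" "scaleC :: complex \<Rightarrow> 'a \<Rightarrow> 'a" p
    by (rule lin)
  have pD: "p ` D \<subseteq> {0}" using p E(1) by auto
  have pW: "p w = 0" if "w \<in> W" for w
  proof -
    have "p w \<in> cvec.span (p ` D)"
      using that D(3) p.span_image[of D] by blast
    then show ?thesis using cvec.span_mono[OF pD] by auto
  qed
  have pX: "p ` X = X" using p by (auto simp: X_def image_def)
  have pXid: "p s = s" if "s \<in> cvec.span X" for s
  proof -
    have "cvec.subspace {s. p s = s}"
      by (auto simp: cvec.subspace_def p.add p.scale)
    moreover have "X \<subseteq> {s. p s = s}" using p by (auto simp: X_def)
    ultimately show ?thesis using cvec.span_minimal that by blast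
  qed
  have kerp: "v \<in> W" if v: "v \<in> V" "p v = 0" for v
  proof -
    have "v \<in> cvec.span (W \<union> X)" using spanX v by blast
    then obtain w s where ws: "v = w + s" "w \<in> cvec.span W" "s \<in> cvec.span X"
      unfolding cvec.span_Un by blast
    have "w \<in> W" using ws(2) W by (simp add: cvec.span_eq_iff[THEN iffD2])
    then have "s = 0" using v(2) ws pW pXid by (simp add: p.add)
    then show ?thesis using ws \<open>w \<in> W\<close> by simp
  qed
  have span_eq: "cvec.span (p ` Y) = p ` V" if Y: "basis_mod V W Y" for Y
  proof -
    have sp: "cvec.span (W \<union> Y) = V"
    proof
      show "cvec.span (W \<union> Y) \<subseteq> V"
        using Y WV V cvec.span_minimal[of "W \<union> Y" V] by (auto simp: basis_mod_def)
      show "V \<subseteq> cvec.span (W \<union> Y)" using Y by (simp add: basis_mod_def)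
    qed
    have "p ` W = {0}" using pW W cvec.subspace_0 by force
    then have "cvec.span (p ` (W \<union> Y)) = cvec.span (p ` Y)"
      by (simp add: image_Un)
    then show ?thesis using p.span_image[of "W \<union> Y"] sp by simp
  qed
  have indep: "p b \<notin> cvec.span (p ` (Y - {b}))" if Y: "basis_mod V W Y" and b: "b \<in> Y" for Y b
  proof
    assume "p b \<in> cvec.span (p ` (Y - {b}))"
    then obtain s where s: "s \<in> cvec.span (Y - {b})" "p b = p s"
      using p.span_image[of "Y - {b}"] by blast
    have YV: "Y \<subseteq> V" using Y by (simp add: basis_mod_def)
    have "s \<in> V" using s(1) YV V cvec.span_minimal[of "Y - {b}" V] by blast
    then have "b - s \<in> W"
      using kerp[of "b - s"] s(2) b YV V by (auto simp: p.diff cvec.subspace_diff)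
    then have "b - s \<in> cvec.span (W \<union> (Y - {b}))" by (simp add: cvec.span_base)
    moreover have "s \<in> cvec.span (W \<union> (Y - {b}))"
      using s(1) cvec.span_mono[of "Y - {b}" "W \<union> (Y - {b})"] by blast
    ultimately have "(b - s) + s \<in> cvec.span (W \<union> (Y - {b}))" by (rule cvec.span_add)
    then show False using Y b by (simp add: basis_mod_def)
  qed
  have bij: "\<exists>f. bij_betw f Y X" if Y: "basis_mod V W Y" for Y
  proof -
    have inj: "inj_on p Y"
    proof (rule inj_onI, rule ccontr)
      fix b c assume "b \<in> Y" "c \<in> Y" "p b = p c" "b \<noteq> c"
      then have "p b \<in> cvec.span (p ` (Y - {b}))" by (intro cvec.span_base) auto
      then show False using indep[OF Y \<open>b \<in> Y\<close>] by simp
    qed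
    have "cvec.independent (p ` Y)"
    proof -
      have "p b \<notin> cvec.span (p ` Y - {p b})" if "b \<in> Y" for b
      proof -
        have "p ` Y - {p b} \<subseteq> p ` (Y - {b})" by auto
        then show ?thesis using indep[OF Y that] cvec.span_mono by blast
      qed
      then show ?thesis unfolding cvec.dependent_def by blast
    qed
    moreover have "cvec.independent X"
      unfolding X_def by (rule cvec.independent_mono[OF E(3)]) auto
    moreover have "cvec.span (p ` Y) = cvec.span X"
      using span_eq[OF Y] span_eq[OF basisX] pX by simp
    ultimately obtain g where "bij_betw g (p ` Y) X"
      using cvec.bij_if_span_eq_span_bases by blast
    moreover have "bij_betw p Y (p ` Y)" using inj by (simp add: bij_betw_def)
    ultimately show ?thesis using bij_betw_trans by blast
  qed
  show thesis using that[OF basisX] bij by blast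
qed

lemma quot_dim_eq_card_of:
  fixes V W X :: "'a::complex_inner set"
  assumes "cvec.subspace W" and "cvec.subspace V" and "W \<subseteq> V" and X: "basis_mod V W X"
  shows "quot_dim V W =o |X|"
proof -
  obtain Z :: "'a set" where Z: "\<And>Y. basis_mod V W Y \<Longrightarrow> \<exists>f. bij_betw f Y Z"
    using basis_mod_exists_bij[OF assms(1-3)] by blast
  have "|Y| =o |Z|" if "basis_mod V W Y" for Y
    using Z[OF that] by (simp add: card_of_ordIso)
  moreover have "basis_mod V W (SOME X. basis_mod V W X)" using X by (rule someI)
  ultimately show ?thesis
    unfolding quot_dim_def using X ordIso_symmetric ordIso_transitive by blast
qed


section \<open>Unbounded operators\<close>

text \<open>
  A (partially defined) linear operator is identified with its graph, so that its domain is
  the set \<open>Domain T\<close>, it is closed iff the set \<open>T\<close> is closed, and equality of operators, including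
  equality of domains, is equality of sets.
\<close>

type_synonym 'a operator = "('a \<times> 'a) set"

definition linear_operator :: "'a::complex_inner operator \<Rightarrow> bool" where
  "linear_operator T \<longleftrightarrow> cvec.subspace T \<and> single_valued T"

definition densely_defined :: "'a::complex_inner operator \<Rightarrow> bool" where
  "densely_defined T \<longleftrightarrow> closure (Domain T) = UNIV"

definition adjoint_operator :: "'a::complex_inner operator \<Rightarrow> 'a operator" where
  "adjoint_operator T = {(g, h). \<forall>(f, Tf) \<in> T. cinner Tf g = cinner f h}"

definition dual_pair :: "'a::complex_inner operator \<Rightarrow> 'a operator \<Rightarrow> bool" where
  "dual_pair A B \<longleftrightarrow> (\<forall>(f, Af) \<in> A. \<forall>(g, Bg) \<in> B. cinner Af g = cinner f Bg)"

definition symmetric_operator :: "'a::complex_inner operator \<Rightarrow> bool" where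
  "symmetric_operator T \<longleftrightarrow> linear_operator T \<and> densely_defined T \<and>
     (\<forall>(f, Tf) \<in> T. \<forall>(g, Tg) \<in> T. cinner Tf g = cinner f Tg)"

definition selfadjoint_operator :: "'a::complex_inner operator \<Rightarrow> bool" where
  "selfadjoint_operator T \<longleftrightarrow> linear_operator T \<and> densely_defined T \<and> T = adjoint_operator T"

text \<open>\<open>T - z\<close>, with domain \<open>Domain T\<close>\<close>
definition op_minus_scalar :: "'a::complex_inner operator \<Rightarrow> complex \<Rightarrow> 'a operator" where
  "op_minus_scalar T z = {(f, Tf - z *\<^sub>C f) | f Tf. (f, Tf) \<in> T}"

definition op_kernel :: "'a::complex_inner operator \<Rightarrow> 'a set" where
  "op_kernel T = {f. (f, 0) \<in> T}"

definition n_plus :: "'a::complex_inner operator \<Rightarrow> 'a rel" where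
  "n_plus T = cdimension (op_kernel (op_minus_scalar (adjoint_operator T) \<i>))"

definition n_minus :: "'a::complex_inner operator \<Rightarrow> 'a rel" where
  "n_minus T = cdimension (op_kernel (op_minus_scalar (adjoint_operator T) (- \<i>)))"

definition n_dom :: "'a::complex_inner operator \<Rightarrow> 'a operator \<Rightarrow> 'a rel" where
  "n_dom T U = quot_dim (Domain T) (Domain U)"

text \<open>The block matrix with zero diagonal, upper right entry \<open>A\<close> and lower left entry \<open>B\<close>.\<close>
definition offdiag :: "'a::complex_inner operator \<Rightarrow> 'a operator \<Rightarrow> ('a \<times> 'a) operator" where
  "offdiag A B = {((f, g), (Ag, Bf)) | f g Ag Bf. (f, Bf) \<in> B \<and> (g, Ag) \<in> A}"

lemma Domain_offdiag: "Domain (offdiag A B) = Domain B \<times> Domain A"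
  unfolding offdiag_def by blast

end

theory Submission
  imports Defs
begin

text \<open>
  The adjoint of the block operator \<open>S = offdiag A B\<close> is the block operator with entries
  \<open>B\<^sup>*\<close> and \<open>A\<^sup>*\<close>.  Hence, for \<open>z = \<plusminus>\<i>\<close>, the space \<open>ker (S\<^sup>* - z)\<close> consists of the pairs
  \<open>(f, g)\<close> with \<open>A\<^sup>* f = z g\<close> and \<open>B\<^sup>* g = z f\<close>.  As \<open>z\<^sup>2 = -1\<close>, this condition says that the
  point \<open>(f, z g)\<close> of the graph of \<open>A\<^sup>*\<close> is orthogonal to the graph of \<open>B\<close>.  The graph of \<open>B\<close>
  is closed and contained in that of \<open>A\<^sup>*\<close>, so the projection theorem in \<open>H \<oplus> H\<close> splits the
  graph of \<open>A\<^sup>*\<close> orthogonally into the graph of \<open>B\<close> and a copy of \<open>ker (S\<^sup>* - z)\<close>.  Reading off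
  first components, \<open>(f, g) \<mapsto> f\<close> induces an isomorphism of \<open>ker (S\<^sup>* - z)\<close> onto
  \<open>dom A\<^sup>* / dom B\<close>.  The condition on \<open>(f, g)\<close> is symmetric under exchanging \<open>(A, f)\<close> with
  \<open>(B, g)\<close>, so \<open>(f, g) \<mapsto> g\<close> induces an isomorphism onto \<open>dom B\<^sup>* / dom A\<close>.  This holds for
  both signs of \<open>z\<close>, and all four dimensions agree.

  By the formula for \<open>S\<^sup>*\<close>, selfadjointness of \<open>S\<close> means \<open>A = B\<^sup>*\<close> and \<open>B = A\<^sup>*\<close>.  The second
  equality follows from the first, because a closed operator equals its double adjoint; this
  is again the projection theorem, applied to the graph of \<open>B\<close>.
\<close>


section \<open>The inner product and the projection theorem\<close>

lemma cinner_add_right: "cinner x (y + z) = cinner x y + cinner x z"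
  by (metis cinner_add_left cinner_commute complex_cnj_add)

lemma cinner_scaleC_right: "cinner x (c *\<^sub>C y) = cnj c * cinner x y"
  by (metis cinner_commute cinner_scaleC_left complex_cnj_mult)

lemma cinner_zero_left [simp]: "cinner 0 y = 0"
  using cinner_add_left[of 0 0 y] by simp

lemma cinner_zero_right [simp]: "cinner x 0 = 0"
  using cinner_add_right[of x 0 0] by simp

lemma cinner_minus_left: "cinner (- x) y = - cinner x y"
  using cinner_add_left[of x "- x" y] by (simp add: eq_neg_iff_add_eq_0 add.commute)

lemma cinner_minus_right: "cinner x (- y) = - cinner x y"
  using cinner_add_right[of x y "- y"] by (simp add: eq_neg_iff_add_eq_0 add.commute)

lemma cinner_diff_right: "cinner z (x - y) = cinner z x - cinner z y"
  using cinner_add_right[of z x "- y"] by (simp add: cinner_minus_right)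

lemma cinner_self: "cinner x x = complex_of_real ((norm x)\<^sup>2)"
proof (rule complex_eqI)
  show "Re (cinner x x) = Re (complex_of_real ((norm x)\<^sup>2))"
    by (simp add: inner_cinner[symmetric] power2_norm_eq_inner)
  show "Im (cinner x x) = Im (complex_of_real ((norm x)\<^sup>2))"
    using arg_cong[OF cinner_commute[of x x], of Im] by simp
qed

lemma scaleC_Pair [simp]: "c *\<^sub>C (x, y) = (c *\<^sub>C x, c *\<^sub>C y)"
  by (simp add: scaleC_prod_def)

lemma cinner_Pair [simp]: "cinner (a, b) (c, d) = cinner a c + cinner b d"
  by (simp add: cinner_prod_def)

text \<open>
  If \<open>z\<close> is a shortest vector of \<open>z + \<real>u\<close>, the derivative of \<open>t \<mapsto> \<parallel>z - t u\<parallel>\<^sup>2\<close> vanishes at \<open>0\<close>.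
\<close>
lemma inner_eq_0_if_shortest:
  fixes z u :: "'a::real_inner"
  assumes "\<And>t. norm z \<le> norm (z - t *\<^sub>R u)"
  shows "inner z u = 0"
proof (cases "u = 0")
  case False
  \<comment> \<open>the minimiser of the quadratic polynomial in \<open>t\<close>\<close>
  define t where "t = inner z u / (norm u)\<^sup>2"
  have "(norm z)\<^sup>2 \<le> (norm (z - t *\<^sub>R u))\<^sup>2"
    using assms by (intro power_mono) auto
  also have "\<dots> = (norm z)\<^sup>2 - 2 * t * inner z u + t\<^sup>2 * (norm u)\<^sup>2"
    unfolding power2_norm_eq_inner
    by (simp add: inner_diff inner_commute power2_eq_square algebra_simps)
  also have "\<dots> = (norm z)\<^sup>2 - (inner z u)\<^sup>2 / (norm u)\<^sup>2"
    using False by (simp add: t_def field_simps power2_eq_square)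
  finally have "(inner z u)\<^sup>2 / (norm u)\<^sup>2 \<le> 0" by simp
  then show ?thesis using False by (simp add: divide_le_0_iff)
qed simp

text \<open>
  A sequence in the subspace whose distances to \<open>x\<close> approach the infimum is Cauchy by the
  parallelogram identity, since midpoints of its terms are again at least that far from \<open>x\<close>.
\<close>
lemma nearest_point_exists:
  fixes M :: "'a::{real_inner, complete_space} set"
  assumes M: "subspace M" and cl: "closed M"
  obtains m where "m \<in> M" and "\<And>u. u \<in> M \<Longrightarrow> norm (x - m) \<le> norm (x - u)"
proof -
  define D where "D = (\<lambda>m. (norm (x - m))\<^sup>2) ` M"
  define d where "d = Inf D"
  have D0: "D \<noteq> {}" using subspace_0[OF M] by (auto simp: D_def)
  have bdd: "bdd_below D" by (rule bdd_belowI[of _ 0]) (auto simp: D_def)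
  have lower: "d \<le> (norm (x - u))\<^sup>2" if "u \<in> M" for u
    unfolding d_def by (rule cInf_lower[OF _ bdd]) (use that in \<open>auto simp: D_def\<close>)
  have "\<exists>u\<in>M. (norm (x - u))\<^sup>2 < d + 1 / real (Suc n)" for n
  proof -
    have "Inf D < d + 1 / real (Suc n)" by (simp add: d_def)
    then show ?thesis using cInf_lessD[OF D0] by (fastforce simp: D_def)
  qed
  then obtain s where s: "\<And>n. s n \<in> M" "\<And>n. (norm (x - s n))\<^sup>2 < d + 1 / real (Suc n)"
    by metis
  have close: "(dist (s p) (s q))\<^sup>2 < 4 / real (Suc N)" if "N \<le> p" "N \<le> q" for N p q
  proof -
    define c where "c = (1/2) *\<^sub>R (s p + s q)"
    have "c \<in> M" unfolding c_def using s(1) M by (intro subspace_scale subspace_add) auto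
    have "(dist (s p) (s q))\<^sup>2
        = 2 * (norm (x - s p))\<^sup>2 + 2 * (norm (x - s q))\<^sup>2 - 4 * (norm (x - c))\<^sup>2"
      unfolding c_def dist_norm power2_norm_eq_inner
      by (simp add: inner_diff inner_add inner_commute algebra_simps)
    also have "\<dots> < 2 * (d + 1 / real (Suc p)) + 2 * (d + 1 / real (Suc q)) - 4 * d"
    proof -
      have "2 * a + 2 * b - 4 * e < 2 * (d + k) + 2 * (d + l) - 4 * d"
        if "a < d + k" "b < d + l" "d \<le> e" for a b e k l :: real
        using that by argo
      then show ?thesis using s(2) s(2) lower[OF \<open>c \<in> M\<close>] by blast
    qed
    also have "\<dots> \<le> 4 / real (Suc N)"
    proof -
      have "1 / real (Suc p) \<le> 1 / real (Suc N)" "1 / real (Suc q) \<le> 1 / real (Suc N)"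
        using that by (auto intro: divide_left_mono)
      then show ?thesis by simp
    qed
    finally show ?thesis .
  qed
  have "Cauchy s"
  proof (rule metric_CauchyI)
    fix e :: real assume "e > 0"
    obtain N where "4 / e\<^sup>2 < real N" using reals_Archimedean2 by blast
    then have N: "4 / real (Suc N) < e\<^sup>2"
      using \<open>e > 0\<close> by (simp add: field_simps) (smt (verit) zero_less_power)
    have "dist (s p) (s q) < e" if "N \<le> p" "N \<le> q" for p q
      using close[OF that] N \<open>e > 0\<close> by (intro power_less_imp_less_base[of _ 2 e]) auto
    then show "\<exists>N. \<forall>p\<ge>N. \<forall>q\<ge>N. dist (s p) (s q) < e" by blast
  qed
  then obtain m where lim: "s \<longlonglongrightarrow> m" using Cauchy_convergent convergent_def by blast
  have "m \<in> M" using cl s(1) lim closed_sequentially by blast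
  moreover have "norm (x - m) \<le> norm (x - u)" if "u \<in> M" for u
  proof -
    have "(\<lambda>n. (norm (x - s n))\<^sup>2) \<longlonglongrightarrow> (norm (x - m))\<^sup>2"
      by (intro tendsto_intros lim)
    moreover have "(\<lambda>n. d + 1 / real (Suc n)) \<longlonglongrightarrow> d + 0"
      by (intro tendsto_add tendsto_const LIMSEQ_Suc[OF lim_1_over_n])
    ultimately have "(norm (x - m))\<^sup>2 \<le> d + 0"
      by (rule LIMSEQ_le) (use s(2) less_imp_le in blast)
    also have "\<dots> \<le> (norm (x - u))\<^sup>2" using lower[OF that] by simp
    finally show ?thesis by (rule power2_le_imp_le) simp
  qed
  ultimately show thesis by (rule that)
qed

text \<open>
  Real orthogonality to a complex subspace is complex orthogonality: the imaginary part of
  \<open>cinner y u\<close> is the real inner product of \<open>y\<close> and \<open>\<i> u\<close>.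
\<close>
lemma orthogonal_decomposition:
  fixes M :: "'a::chilbert_space set"
  assumes M: "cvec.subspace M" and "closed M"
  obtains m y where "m \<in> M" and "x = m + y" and "\<And>u. u \<in> M \<Longrightarrow> cinner u y = 0"
proof -
  have "subspace M"
    using M by (auto simp: subspace_def cvec.subspace_def scaleR_scaleC)
  then obtain m where m: "m \<in> M" "\<And>u. u \<in> M \<Longrightarrow> norm (x - m) \<le> norm (x - u)"
    using nearest_point_exists \<open>closed M\<close> by blast
  have inner0: "inner (x - m) u = 0" if "u \<in> M" for u
  proof (rule inner_eq_0_if_shortest)
    fix t
    have "m + t *\<^sub>R u \<in> M"
      using \<open>subspace M\<close> m(1) that by (intro subspace_add subspace_scale) auto
    then show "norm (x - m) \<le> norm (x - m - t *\<^sub>R u)"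
      using m(2) by (simp add: diff_diff_add)
  qed
  have "cinner (x - m) u = 0" if "u \<in> M" for u
  proof (rule complex_eqI)
    show "Re (cinner (x - m) u) = Re 0" using inner0[OF that] by (simp add: inner_cinner)
    have "\<i> *\<^sub>C u \<in> M" using M that by (rule cvec.subspace_scale)
    then show "Im (cinner (x - m) u) = Im 0"
      using inner0 by (force simp: inner_cinner cinner_scaleC_right)
  qed
  then have "cinner u (x - m) = 0" if "u \<in> M" for u
    using that by (simp add: cinner_commute[of u])
  then show thesis using that[of m "x - m"] m(1) by simp
qed


section \<open>Dimension of a quotient from a linear map\<close>

text \<open>
  The hypotheses express that \<open>k \<mapsto> p k + W\<close> is an isomorphism of \<open>K\<close> onto \<open>V / W\<close> without
  mentioning the quotient.  Such a map carries a basis of \<open>K\<close> to a basis of \<open>V\<close> modulo \<open>W\<close>.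
\<close>
lemma cdimension_eq_quot_dim:
  fixes p :: "'b::complex_inner \<Rightarrow> 'a::complex_inner"
  assumes lin: "Vector_Spaces.linear (*\<^sub>C) (*\<^sub>C) p"
    and K: "cvec.subspace K" and V: "cvec.subspace V" and W: "cvec.subspace W" and "W \<subseteq> V"
    and into: "\<And>k. k \<in> K \<Longrightarrow> p k \<in> V"
    and inj: "\<And>k. k \<in> K \<Longrightarrow> p k \<in> W \<Longrightarrow> k = 0"
    and onto: "\<And>v. v \<in> V \<Longrightarrow> \<exists>w\<in>W. \<exists>k\<in>K. v = w + p k"
  shows "cdimension K =o quot_dim V W"
proof -
  interpret p: Vector_Spaces.linear "scaleC :: complex \<Rightarrow> 'b \<Rightarrow> 'b" "scaleC :: complex \<Rightarrow> 'a \<Rightarrow> 'a" p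
    by (rule lin)
  have zero: "cvec.subspace {0::'b}" "{0} \<subseteq> K"
    using cvec.subspace_0[OF K] cvec.subspace_single_0 by auto
  obtain X where X: "basis_mod K {0} X"
    using basis_mod_exists_bij[OF zero(1) K zero(2)] by blast
  have XK: "X \<subseteq> K" and spanX: "K \<subseteq> cvec.span X"
    and indep: "\<And>b. b \<in> X \<Longrightarrow> b \<notin> cvec.span (X - {b})"
    using X by (auto simp: basis_mod_def)
  have "inj_on p X"
  proof (rule inj_onI)
    fix b c assume bc: "b \<in> X" "c \<in> X" "p b = p c"
    then have "b - c \<in> K" using XK K by (auto intro: cvec.subspace_diff)
    then show "b = c" using inj[of "b - c"] bc W by (simp add: p.diff cvec.subspace_0)
  qed
  have "p b \<notin> cvec.span (W \<union> (p ` X - {p b}))" if b: "b \<in> X" for b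
  proof
    assume "p b \<in> cvec.span (W \<union> (p ` X - {p b}))"
    moreover have "p ` X - {p b} = p ` (X - {b})"
      using inj_on_image_set_diff[OF \<open>inj_on p X\<close>, of X "{b}"] b by simp
    ultimately have "p b \<in> cvec.span (W \<union> p ` (X - {b}))" by simp
    also have "\<dots> = {w + y |w y. w \<in> W \<and> y \<in> p ` cvec.span (X - {b})}"
      by (simp only: cvec.span_Un p.span_image cvec.span_eq_iff[THEN iffD2, OF W])
    finally obtain w t where wt: "p b = w + p t" "w \<in> W" "t \<in> cvec.span (X - {b})"
      by blast
    have "t \<in> K" using wt(3) cvec.span_minimal[of "X - {b}" K] XK K by blast
    then have "b - t \<in> K" using b XK K by (auto intro: cvec.subspace_diff)
    then have "b = t" using inj[of "b - t"] wt by (simp add: p.diff)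
    then show False using indep[OF b] wt(3) by simp
  qed
  moreover have "V \<subseteq> cvec.span (W \<union> p ` X)"
  proof
    fix v assume "v \<in> V"
    then obtain w k where "w \<in> W" "k \<in> K" "v = w + p k" using onto by blast
    moreover have "p k \<in> cvec.span (p ` X)"
      using \<open>k \<in> K\<close> spanX p.span_image[of X] by blast
    ultimately show "v \<in> cvec.span (W \<union> p ` X)"
      unfolding cvec.span_Un using cvec.span_base[of w W] by blast
  qed
  ultimately have "basis_mod V W (p ` X)"
    using into XK by (auto simp: basis_mod_def)
  then have VW: "quot_dim V W =o |p ` X|"
    by (rule quot_dim_eq_card_of[OF W V \<open>W \<subseteq> V\<close>])
  have "cdimension K =o |X|"
    unfolding cdimension_def by (rule quot_dim_eq_card_of[OF zero(1) K zero(2) X])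
  also have "|X| =o |p ` X|"
    using inj_on_imp_bij_betw[OF \<open>inj_on p X\<close>] card_of_ordIso[of X "p ` X"] by blast
  finally show ?thesis using ordIso_symmetric[OF VW] by (rule ordIso_transitive)
qed

lemma linear_fst_scaleC:
  "Vector_Spaces.linear (*\<^sub>C) (*\<^sub>C) (fst :: 'a::complex_inner \<times> 'b::complex_inner \<Rightarrow> 'a)"
  by unfold_locales (simp_all add: scaleC_prod_def)

lemma linear_snd_scaleC:
  "Vector_Spaces.linear (*\<^sub>C) (*\<^sub>C) (snd :: 'a::complex_inner \<times> 'b::complex_inner \<Rightarrow> 'b)"
  by unfold_locales (simp_all add: scaleC_prod_def)


section \<open>Adjoints\<close>

lemma adjoint_operator_iff:
  "(g, h) \<in> adjoint_operator T \<longleftrightarrow> (\<forall>f Tf. (f, Tf) \<in> T \<longrightarrow> cinner Tf g = cinner f h)"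
  by (auto simp: adjoint_operator_def)

lemma subspace_adjoint: "cvec.subspace (adjoint_operator T)"
  by (auto simp: cvec.subspace_def adjoint_operator_iff zero_prod_def cinner_add_right
      cinner_scaleC_right)

lemma subspace_Domain:
  fixes T :: "'a::complex_inner operator"
  assumes "cvec.subspace T"
  shows "cvec.subspace (Domain T)"
proof -
  interpret l: Vector_Spaces.linear "scaleC :: complex \<Rightarrow> 'a \<times> 'a \<Rightarrow> 'a \<times> 'a"
    "scaleC :: complex \<Rightarrow> 'a \<Rightarrow> 'a" fst
    by (rule linear_fst_scaleC)
  show ?thesis using l.subspace_image[OF assms] by (simp add: Domain_fst)
qed

text \<open>Two values of the adjoint at a point differ by a vector orthogonal to a dense set.\<close>
lemma single_valued_adjoint:
  fixes T :: "'a::complex_inner operator"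
  assumes "densely_defined T"
  shows "single_valued (adjoint_operator T)"
proof (rule single_valuedI)
  fix g h k assume gh: "(g, h) \<in> adjoint_operator T" "(g, k) \<in> adjoint_operator T"
  have "Domain T \<subseteq> {f. inner f (h - k) = 0}"
    using gh by (fastforce simp: adjoint_operator_iff inner_cinner cinner_diff_right)
  moreover have "closed {f. inner f (h - k) = 0}"
    by (intro closed_Collect_eq continuous_intros)
  ultimately have "closure (Domain T) \<subseteq> {f. inner f (h - k) = 0}"
    by (rule closure_minimal)
  then have "h - k \<in> {f. inner f (h - k) = 0}"
    using assms unfolding densely_defined_def by blast
  then show "h = k" by simp
qed

lemma dual_pair_iff_subset_adjoint: "dual_pair A B \<longleftrightarrow> B \<subseteq> adjoint_operator A"
  unfolding dual_pair_def adjoint_operator_def by blast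

lemma dual_pair_commute:
  assumes "dual_pair A B"
  shows "dual_pair B A"
proof -
  have "cinner Bg f = cinner g Af" if "(f, Af) \<in> A" "(g, Bg) \<in> B" for f Af g Bg
  proof -
    have "cinner Af g = cinner f Bg" using assms that by (auto simp: dual_pair_def)
    then show ?thesis by (simp add: cinner_commute[of Bg] cinner_commute[of g])
  qed
  then show ?thesis by (auto simp: dual_pair_def)
qed

text \<open>
  The classical description of the adjoint as the rotated orthogonal complement of the graph.
  It turns the complement supplied by the projection theorem into a condition on \<open>T\<^sup>*\<close>.
\<close>
lemma orthogonal_to_graph_iff:
  "(\<forall>w\<in>T. cinner w (u, v) = 0) \<longleftrightarrow> (v, - u) \<in> adjoint_operator T"
  by (auto simp: adjoint_operator_iff cinner_minus_right eq_neg_iff_add_eq_0 add.commute)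

text \<open>
  The projection onto the graph of \<open>B\<close> stays inside the graph of \<open>A\<^sup>*\<close>, because the latter
  contains the former; so the remainder \<open>(u, v)\<close> belongs to \<open>A\<^sup>*\<close> as well.
\<close>
lemma adjoint_decomposition:
  fixes A B :: "'a::chilbert_space operator"
  assumes "cvec.subspace B" and "closed B" and "dual_pair A B"
    and "(f, h) \<in> adjoint_operator A"
  obtains b Bb u v where "(b, Bb) \<in> B" and "f = b + u" and "h = Bb + v"
    and "(u, v) \<in> adjoint_operator A" and "(v, - u) \<in> adjoint_operator B"
proof -
  obtain m y where my: "m \<in> B" "(f, h) = m + y" "\<And>w. w \<in> B \<Longrightarrow> cinner w y = 0"
    using orthogonal_decomposition[OF assms(1,2)] by metis
  obtain b Bb u v where [simp]: "m = (b, Bb)" "y = (u, v)" by fastforce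
  have "m \<in> adjoint_operator A"
    using my(1) assms(3) by (auto simp: dual_pair_iff_subset_adjoint)
  then have "(f, h) - m \<in> adjoint_operator A"
    by (rule cvec.subspace_diff[OF subspace_adjoint assms(4)])
  then have "(u, v) \<in> adjoint_operator A" using my(2) by simp
  moreover have "(v, - u) \<in> adjoint_operator B"
    using my(3) by (simp flip: orthogonal_to_graph_iff)
  ultimately show thesis using that my by simp
qed

text \<open>
  If \<open>(u, v)\<close> lies in \<open>A\<^sup>*\<close> and is orthogonal to \<open>B\<close>, then \<open>(v, -u) \<in> B\<^sup>* = A\<close>, so that pairing
  it with \<open>(u, v)\<close> gives \<open>\<parallel>u\<parallel>\<^sup>2 + \<parallel>v\<parallel>\<^sup>2 = 0\<close>.
\<close>
lemma double_adjoint: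
  fixes A B :: "'a::chilbert_space operator"
  assumes "cvec.subspace B" and "closed B" and "dual_pair A B" and A: "A = adjoint_operator B"
  shows "B = adjoint_operator A"
proof
  show "B \<subseteq> adjoint_operator A" using assms(3) by (simp add: dual_pair_iff_subset_adjoint)
  show "adjoint_operator A \<subseteq> B"
  proof (rule subrelI)
    fix f h assume "(f, h) \<in> adjoint_operator A"
    then obtain b Bb u v where d: "(b, Bb) \<in> B" "f = b + u" "h = Bb + v"
      and uv: "(u, v) \<in> adjoint_operator A" "(v, - u) \<in> adjoint_operator B"
      using adjoint_decomposition[OF assms(1-3)] by metis
    from uv have "cinner (- u) u = cinner v v"
      using A by (auto simp: adjoint_operator_iff)
    then have "Re (cinner (- u) u) = Re (cinner v v)" by simp
    then have "- (norm u)\<^sup>2 = (norm v)\<^sup>2" by (simp add: cinner_minus_left cinner_self)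
    then have "(norm u)\<^sup>2 + (norm v)\<^sup>2 = 0" by linarith
    then have "u = 0" "v = 0" by (simp_all add: sum_power2_eq_zero_iff)
    then show "(f, h) \<in> B" using d by simp
  qed
qed


section \<open>The block operator and its defect spaces\<close>

lemma offdiag_iff: "((f, g), (h, k)) \<in> offdiag A B \<longleftrightarrow> (g, h) \<in> A \<and> (f, k) \<in> B"
  by (auto simp: offdiag_def)

lemma adjoint_offdiag:
  assumes A: "cvec.subspace A" and B: "cvec.subspace B"
  shows "adjoint_operator (offdiag A B) = offdiag (adjoint_operator B) (adjoint_operator A)"
proof -
  have zero: "(0, 0) \<in> A" "(0, 0) \<in> B"
    using cvec.subspace_0[OF A] cvec.subspace_0[OF B] by (simp_all add: zero_prod_def)
  have "((f, g), (h, k)) \<in> adjoint_operator (offdiag A B) \<longleftrightarrow>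
      (g, h) \<in> adjoint_operator B \<and> (f, k) \<in> adjoint_operator A" (is "?l \<longleftrightarrow> ?r") for f g h k
  proof
    assume ?l
    then have *: "cinner Av f + cinner Bu g = cinner u h + cinner v k"
      if "(u, Bu) \<in> B" "(v, Av) \<in> A" for u v Av Bu
      using that unfolding adjoint_operator_iff by (metis offdiag_iff cinner_Pair)
    \<comment> \<open>testing against \<open>(u, 0)\<close> and \<open>(0, v)\<close> separates the two entries\<close>
    show ?r
      using *[OF _ zero(1)] *[OF zero(2)] by (simp add: adjoint_operator_iff)
  next
    assume ?r
    then show ?l by (auto simp: adjoint_operator_iff offdiag_iff)
  qed
  then have "(p, q) \<in> adjoint_operator (offdiag A B) \<longleftrightarrow>
      (p, q) \<in> offdiag (adjoint_operator B) (adjoint_operator A)" for p q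
    by (cases p; cases q) (simp add: offdiag_iff)
  then show ?thesis by auto
qed

lemma symmetric_offdiag:
  assumes A: "linear_operator A" "densely_defined A"
    and B: "linear_operator B" "densely_defined B" and "dual_pair A B"
  shows "symmetric_operator (offdiag A B)"
proof -
  have "cvec.subspace (offdiag A B)"
    using A(1) B(1)
    by (auto simp: linear_operator_def cvec.subspace_def offdiag_iff zero_prod_def split_paired_all)
       (metis add_Pair scaleC_Pair)+
  moreover have "single_valued (offdiag A B)"
    using A(1) B(1) by (auto simp: linear_operator_def single_valued_def offdiag_iff)
  moreover have "densely_defined (offdiag A B)"
    using A(2) B(2) by (simp add: densely_defined_def Domain_offdiag closure_Times)
  moreover have "cinner Tf g = cinner f Tg"
    if "(f, Tf) \<in> offdiag A B" "(g, Tg) \<in> offdiag A B" for f Tf g Tg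
    using that \<open>dual_pair A B\<close> dual_pair_commute[OF \<open>dual_pair A B\<close>]
    by (cases f; cases Tf; cases g; cases Tg) (force simp: offdiag_iff dual_pair_def)
  ultimately show ?thesis by (auto simp: symmetric_operator_def linear_operator_def)
qed

lemma selfadjoint_offdiag_iff:
  fixes A B :: "'a::chilbert_space operator"
  assumes A: "linear_operator A" "densely_defined A"
    and B: "linear_operator B" "densely_defined B" "closed B" and AB: "dual_pair A B"
  shows "selfadjoint_operator (offdiag A B) \<longleftrightarrow> A = adjoint_operator B"
proof -
  have sub: "cvec.subspace A" "cvec.subspace B"
    using A B by (auto simp: linear_operator_def)
  have zero: "(0, 0) \<in> T" if "cvec.subspace T" for T :: "'a operator"
    using cvec.subspace_0[OF that] by (simp add: zero_prod_def)
  have "offdiag A B = offdiag (adjoint_operator B) (adjoint_operator A) \<longleftrightarrow> A = adjoint_operator B"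
  proof
    assume eq: "offdiag A B = offdiag (adjoint_operator B) (adjoint_operator A)"
    have "(g, h) \<in> A \<longleftrightarrow> (g, h) \<in> adjoint_operator B" for g h
      using eq zero[OF sub(2)] zero[OF subspace_adjoint[of A]] offdiag_iff[of 0 g h 0] by metis
    then show "A = adjoint_operator B" by auto
  next
    assume "A = adjoint_operator B"
    then show "offdiag A B = offdiag (adjoint_operator B) (adjoint_operator A)"
      using double_adjoint[OF sub(2) B(3) AB] by metis
  qed
  then show ?thesis
    using symmetric_offdiag[OF A B(1,2) AB] adjoint_offdiag[OF sub]
    by (simp add: selfadjoint_operator_def symmetric_operator_def)
qed

text \<open>
  The space \<open>ker (S\<^sup>* - z)\<close>, written in the form that shows its symmetry in \<open>A\<close> and \<open>B\<close>.
\<close>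
definition defect_space :: "'a::complex_inner operator \<Rightarrow> 'a operator \<Rightarrow> complex \<Rightarrow> ('a \<times> 'a) set"
  where "defect_space A B z =
    {(f, g). (f, z *\<^sub>C g) \<in> adjoint_operator A \<and> (g, z *\<^sub>C f) \<in> adjoint_operator B}"

lemma op_kernel_offdiag:
  assumes "cvec.subspace A" and "cvec.subspace B"
  shows "op_kernel (op_minus_scalar (adjoint_operator (offdiag A B)) z) = defect_space A B z"
  by (auto simp: adjoint_offdiag[OF assms] op_kernel_def op_minus_scalar_def defect_space_def
      offdiag_iff zero_prod_def)

lemma subspace_defect_space: "cvec.subspace (defect_space A B z)"
proof -
  have comm: "z *\<^sub>C c *\<^sub>C x = c *\<^sub>C z *\<^sub>C x" for c and x :: 'a
    by (simp add: scaleC_scaleC mult.commute)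
  show ?thesis
    unfolding cvec.subspace_def defect_space_def
    by (auto simp: zero_prod_def adjoint_operator_iff scaleC_add_right comm
        cinner_add_right cinner_scaleC_right distrib_left)
qed

lemma defect_space_swap: "(f, g) \<in> defect_space A B z \<longleftrightarrow> (g, f) \<in> defect_space B A z"
  by (auto simp: defect_space_def)

text \<open>
  Since \<open>A\<^sup>*\<close> extends \<open>B\<close> and is single-valued, \<open>(f, z g)\<close> lies in \<open>B\<close>.  It is also orthogonal
  to \<open>B\<close>, hence to itself.
\<close>
lemma defect_space_inter_Domain:
  assumes z: "z * z = -1" and "densely_defined A" and "dual_pair A B"
    and fg: "(f, g) \<in> defect_space A B z" and "f \<in> Domain B"
  shows "(f, g) = 0"
proof -
  obtain h where h: "(f, h) \<in> B" using \<open>f \<in> Domain B\<close> by blast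
  have "h = z *\<^sub>C g"
    using h fg \<open>dual_pair A B\<close> single_valued_adjoint[OF \<open>densely_defined A\<close>]
    by (auto simp: dual_pair_iff_subset_adjoint defect_space_def dest: single_valuedD)
  then have "cinner (z *\<^sub>C g) g = cinner f (z *\<^sub>C f)"
    using h fg by (auto simp: defect_space_def adjoint_operator_iff)
  moreover have "z = \<i> \<or> z = - \<i>"
    using z by (metis i_squared power2_eq_square power2_eq_iff)
  ultimately have "Im (z * cinner g g) = Im (cnj z * cinner f f)" and "z = \<i> \<or> z = - \<i>"
    by (simp_all add: cinner_scaleC_left cinner_scaleC_right)
  then have "(norm g)\<^sup>2 = - (norm f)\<^sup>2"
    by (auto simp: cinner_self)
  then have "(norm f)\<^sup>2 + (norm g)\<^sup>2 = 0" by linarith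
  then show ?thesis by (simp add: sum_power2_eq_zero_iff zero_prod_def)
qed

lemma Domain_adjoint_decomposition:
  fixes A B :: "'a::chilbert_space operator"
  assumes z: "z * z = -1" and "cvec.subspace B" and "closed B" and "dual_pair A B"
    and "f \<in> Domain (adjoint_operator A)"
  obtains b u g where "b \<in> Domain B" and "(u, g) \<in> defect_space A B z" and "f = b + u"
proof -
  obtain h where "(f, h) \<in> adjoint_operator A" using assms(5) by blast
  then obtain b Bb u v where d: "(b, Bb) \<in> B" "f = b + u"
    and uv: "(u, v) \<in> adjoint_operator A" "(v, - u) \<in> adjoint_operator B"
    using adjoint_decomposition[OF assms(2-4)] by metis
  \<comment> \<open>\<open>v = z g\<close> is solved by \<open>g = - z v\<close>\<close>
  have "z *\<^sub>C (- z) *\<^sub>C v = v"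
    using z by (simp add: scaleC_scaleC scaleC_one)
  moreover have "(- z) *\<^sub>C (v, - u) = ((- z) *\<^sub>C v, z *\<^sub>C u)"
    by simp
  ultimately have "(u, (- z) *\<^sub>C v) \<in> defect_space A B z"
    using uv cvec.subspace_scale[OF subspace_adjoint uv(2), of "- z"]
    by (simp add: defect_space_def)
  then show thesis using that d by blast
qed

text \<open>The two coordinate projections of the defect space compute the two quotients.\<close>
lemma cdimension_defect_space:
  fixes A B :: "'a::chilbert_space operator"
  assumes z: "z * z = -1"
    and A: "linear_operator A" "closed A" "densely_defined A"
    and B: "linear_operator B" "closed B" "densely_defined B" and AB: "dual_pair A B"
  shows "cdimension (defect_space A B z) =o n_dom (adjoint_operator A) B"
    and "cdimension (defect_space A B z) =o n_dom (adjoint_operator B) A"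
proof -
  have sub: "cvec.subspace A" "cvec.subspace B"
    using A B by (auto simp: linear_operator_def)
  note BA = dual_pair_commute[OF AB]
  show "cdimension (defect_space A B z) =o n_dom (adjoint_operator A) B"
    unfolding n_dom_def
  proof (rule cdimension_eq_quot_dim[OF linear_fst_scaleC])
    show "Domain B \<subseteq> Domain (adjoint_operator A)"
      using AB by (auto simp: dual_pair_iff_subset_adjoint)
    show "fst k \<in> Domain (adjoint_operator A)" if "k \<in> defect_space A B z" for k
      using that by (auto simp: defect_space_def)
    show "k = 0" if "k \<in> defect_space A B z" "fst k \<in> Domain B" for k
      using defect_space_inter_Domain[OF z A(3) AB] that by (cases k) auto
    show "\<exists>w\<in>Domain B. \<exists>k\<in>defect_space A B z. v = w + fst k"
      if "v \<in> Domain (adjoint_operator A)" for v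
      using Domain_adjoint_decomposition[OF z sub(2) B(2) AB that] by (metis fst_conv)
  qed (intro subspace_defect_space subspace_Domain subspace_adjoint sub)+
  show "cdimension (defect_space A B z) =o n_dom (adjoint_operator B) A"
    unfolding n_dom_def
  proof (rule cdimension_eq_quot_dim[OF linear_snd_scaleC])
    show "Domain A \<subseteq> Domain (adjoint_operator B)"
      using BA by (auto simp: dual_pair_iff_subset_adjoint)
    show "snd k \<in> Domain (adjoint_operator B)" if "k \<in> defect_space A B z" for k
      using that by (auto simp: defect_space_def)
    show "k = 0" if "k \<in> defect_space A B z" "snd k \<in> Domain A" for k
      using defect_space_inter_Domain[OF z B(3) BA, of "snd k" "fst k"] that
      by (cases k) (auto simp: defect_space_swap[of _ _ A] zero_prod_def)
    show "\<exists>w\<in>Domain A. \<exists>k\<in>defect_space A B z. v = w + snd k"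
      if "v \<in> Domain (adjoint_operator B)" for v
      using Domain_adjoint_decomposition[OF z sub(1) A(2) BA that]
      by (metis snd_conv defect_space_swap)
  qed (intro subspace_defect_space subspace_Domain subspace_adjoint sub)+
qed

theorem proposition2p7:
  fixes A B :: "'a::chilbert_space operator"
  assumes "linear_operator A" and "closed A" and "densely_defined A"
    and "linear_operator B" and "closed B" and "densely_defined B"
    and "dual_pair A B"
  shows "(symmetric_operator (offdiag A B) \<and>
          n_plus (offdiag A B) =o n_minus (offdiag A B) \<and>
          n_minus (offdiag A B) =o n_dom (adjoint_operator A) B \<and>
          n_dom (adjoint_operator A) B =o n_dom (adjoint_operator B) A) \<and>
         (selfadjoint_operator (offdiag A B) \<longleftrightarrow> A = adjoint_operator B)"
proof -
  have sub: "cvec.subspace A" "cvec.subspace B"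
    using assms(1,4) by (auto simp: linear_operator_def)
  have plus: "n_plus (offdiag A B) =o n_dom (adjoint_operator A) B"
    unfolding n_plus_def op_kernel_offdiag[OF sub]
    by (rule cdimension_defect_space(1)[OF _ assms]) simp
  have minus: "n_minus (offdiag A B) =o n_dom (adjoint_operator A) B"
    and minus': "n_minus (offdiag A B) =o n_dom (adjoint_operator B) A"
    unfolding n_minus_def op_kernel_offdiag[OF sub]
    by (rule cdimension_defect_space[OF _ assms], simp)+
  have "n_plus (offdiag A B) =o n_minus (offdiag A B)"
    by (rule ordIso_transitive[OF plus ordIso_symmetric[OF minus]])
  moreover have "n_dom (adjoint_operator A) B =o n_dom (adjoint_operator B) A"
    by (rule ordIso_transitive[OF ordIso_symmetric[OF minus] minus'])
  ultimately show ?thesis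
    using minus symmetric_offdiag[OF assms(1,3,4,6,7)]
      selfadjoint_offdiag_iff[OF assms(1,3,4,6,5,7)]
    by simp
qed

end
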